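(* Let $a,b,c\in\mathbb{R}$ with $a\ne0$, and let $x_n=an^2+bn+c$ for $n\ge1$. Then for almost every $\alpha\in\mathbb{R}$, $$\delta_{\min}^{\alpha}(N)<\frac{1}{N^{2-o(1)}},$$ where the rate of decay of the $o(1)$ term depends on $\alpha$.
   Context: For $x\in\mathbb{R}$, $\|x\|=\min_{k\in\mathbb{Z}}|x-k|$. For $\alpha\in\mathbb{R}$, $\delta_{\min}^{\alpha}(N)=\min\{\|\alpha x_m-\alpha x_n\| : 1\le m,n\le N,\ m\ne n\}$. The notation $\frac{1}{N^{2-o(1)}}$ means $N^{-(2-f_\alpha(N))}$ for some function $f_\alpha(N)\to0$ as $N\to\infty$, the inequality holding for all sufficiently large $N$. *)

theory Defs
  imports "HOL-Analysis.Analysis"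
begin

definition dist_int :: "real \<Rightarrow> real" where
  "dist_int x = (INF k::int. \<bar>x - of_int k\<bar>)"

text \<open>Minimal gap of the dilated sequence alpha * x_n modulo 1, over indices 1..N
  (meaningful for N >= 2, where the index set is nonempty).\<close>
definition delta_min :: "real \<Rightarrow> (nat \<Rightarrow> real) \<Rightarrow> nat \<Rightarrow> real" where
  "delta_min \<alpha> x N = Min {dist_int (\<alpha> * x m - \<alpha> * x n) | m n.
      1 \<le> m \<and> m \<le> N \<and> 1 \<le> n \<and> n \<le> N \<and> m \<noteq> n}"

end

theory Submission
  imports Defs "HOL-Probability.Probability" "HOL-Computational_Algebra.Primes"
begin

text \<open>Put \<open>\<beta> = b / (2 a)\<close>; then \<open>x(s + d) - x(s - d) = 4 a d (s + \<beta>)\<close>. For \<open>d \<le> M < s \<le> 2 M\<close>, a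
  trigonometric polynomial of degree about \<open>n = M powr (2 - \<epsilon>)\<close> and mean 1 that is nonpositive at distance
  at least \<open>1 / n\<close> from the integers is summed over all these differences. If none of them, multiplied by
  \<open>\<alpha>\<close>, comes closer than \<open>1 / n\<close> to an integer, the sum deviates from its mean \<open>M\<^sup>2\<close> by at least \<open>M\<^sup>2\<close>. Its
  variance, with \<open>\<alpha>\<close> distributed normally, is controlled by the near coincidences
  \<open>j d (s + \<beta>) \<approx> l d' (s' + \<beta>)\<close>, of which there are only \<open>n M powr (2 + o(1))\<close> by the divisor bound.
  Chebyshev's inequality and the Borel-Cantelli lemma along \<open>M = 2 ^ k\<close> finish the proof.\<close>

subsection \<open>Divisors\<close>

text \<open>A divisor of a product splits into divisors of the factors, so the pairs
  \<open>(i, e)\<close> with \<open>i \<le> k\<close> and \<open>e dvd m\<close> map onto the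
  divisors of \<open>p ^ k * m\<close>.\<close>

lemma card_divisors_prime_power_mult:
  fixes p m k :: nat
  assumes "prime p" "m > 0"
  shows "card {d. d dvd p ^ k * m} \<le> (k + 1) * card {d. d dvd m}"
proof -
  have "{d. d dvd p ^ k * m} \<subseteq> (\<lambda>(i, e). p ^ i * e) ` ({..k} \<times> {d. d dvd m})"
  proof
    fix d assume "d \<in> {d. d dvd p ^ k * m}"
    then obtain x y where "d = x * y" "x dvd p ^ k" "y dvd m"
      using dvd_productE by blast
    moreover then obtain i where "i \<le> k" "x = p ^ i"
      using divides_primepow_nat[OF assms(1)] by blast
    ultimately show "d \<in> (\<lambda>(i, e). p ^ i * e) ` ({..k} \<times> {d. d dvd m})"
      by auto
  qed
  then have "card {d. d dvd p ^ k * m} \<le> card ({..k} \<times> {d. d dvd m})"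
    using assms(2) by (intro surj_card_le) auto
  also have "\<dots> = (k + 1) * card {d. d dvd m}"
    by (simp add: card_cartesian_product)
  finally show ?thesis .
qed

text \<open>Exponential growth beats linear growth. The constant \<open>K\<close> is the price of
  one small prime in the divisor bound.\<close>

lemma Suc_le_const_powr:
  fixes \<eta> :: real
  assumes "\<eta> > 0"
  obtains K where "K \<ge> 1" "\<And>k. real k + 1 \<le> K * 2 powr (\<eta> * real k)"
proof
  show "1 + 1 / (\<eta> * ln 2) \<ge> 1" using assms by simp
  fix k :: nat
  define t where "t = \<eta> * ln 2"
  have t: "t > 0" using assms by (simp add: t_def)
  have "1 + t * real k \<le> exp (t * real k)" by (rule exp_ge_add_one_self)
  moreover have "1 \<le> exp (t * real k)" using t by simp
  ultimately have "(1 + t * real k) / t + 1 \<le> exp (t * real k) / t + exp (t * real k)"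
    using t by (intro add_mono divide_right_mono) auto
  moreover have "real k + 1 \<le> (1 + t * real k) / t + 1" using t by (simp add: field_simps)
  ultimately have "real k + 1 \<le> (1 + 1 / t) * exp (t * real k)" by (simp add: algebra_simps)
  then show "real k + 1 \<le> (1 + 1 / (\<eta> * ln 2)) * 2 powr (\<eta> * real k)"
    by (simp add: t_def powr_def mult_ac)
qed

text \<open>A prime power \<open>p ^ k\<close> contributes at most \<open>k + 1\<close> to the
  number of divisors and \<open>p powr (\<eta> * k)\<close> to the bound. If
  \<open>p \<ge> 2 powr (1 / \<eta>)\<close>, then \<open>p powr \<eta> \<ge> 2\<close> and
  \<open>k + 1 \<le> 2 ^ k\<close> suffices. Each smaller prime costs a factor \<open>K\<close>, and
  there are at most \<open>P\<close> of them.\<close>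

lemma card_divisors_bound:
  fixes \<eta> :: real
  assumes "\<eta> > 0"
  obtains C where "C \<ge> 1" "\<And>n::nat. n > 0 \<Longrightarrow> real (card {d. d dvd n}) \<le> C * real n powr \<eta>"
proof -
  obtain K where K: "K \<ge> 1" "\<And>k. real k + 1 \<le> K * 2 powr (\<eta> * real k)"
    using Suc_le_const_powr[OF assms] by blast
  define P where "P = nat \<lceil>2 powr (1 / \<eta>)\<rceil>"
  define sm where "sm n = {p. prime p \<and> p dvd n \<and> p < P}" for n :: nat
  have fin: "finite (sm n)" for n unfolding sm_def by simp
  \<comment> \<open>The exponent of \<open>K\<close> counts the small primes of \<open>n\<close>.
    The induction strips off one prime with its full multiplicity.\<close>
  have main: "real (card {d. d dvd n}) \<le> K ^ card (sm n) * real n powr \<eta>" if "n > 0" for n :: nat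
    using that
  proof (induction n rule: less_induct)
    case (less n)
    show ?case
    proof (cases "n = 1")
      case True
      then show ?thesis using K(1) by simp
    next
      case False
      then obtain p where p: "prime p" "p dvd n" using prime_factor_nat by blast
      obtain m where m: "n = p ^ multiplicity p n * m" "\<not> p dvd m"
        using multiplicity_decompose'[of n p] less.prems p by (metis not_prime_unit neq0_conv)
      define k where "k = multiplicity p n"
      have k: "k > 0" using p less.prems unfolding k_def
        by (simp add: prime_multiplicity_gt_zero_iff)
      have m0: "m > 0" using m less.prems by (cases m) auto
      have pk: "p ^ k > 1" using p(1) k by (metis one_less_power prime_gt_1_nat)
      have n: "n = p ^ k * m" using m(1) by (simp add: k_def)
      have "m < n" using n pk m0 by simp
      then have IH: "real (card {d. d dvd m}) \<le> K ^ card (sm m) * real m powr \<eta>"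
        using less.IH m0 by blast
      have p2: "real p \<ge> 2" using p(1) prime_ge_2_nat by force
      have sub: "sm m \<subseteq> sm n" unfolding sm_def using n by auto
      have step: "(real k + 1) * K ^ card (sm m) \<le> K ^ card (sm n) * real p powr (\<eta> * real k)"
      proof (cases "p < P")
        case True
        \<comment> \<open>A small prime disappears from \<open>sm\<close> on passing to
          \<open>m\<close>, which frees the factor \<open>K\<close> that pays for
          \<open>k + 1\<close>.\<close>
        have "p \<in> sm n - sm m" using True p m(2) by (simp add: sm_def)
        then have "card (sm m) < card (sm n)" using sub fin by (intro psubset_card_mono) auto
        then have "K ^ Suc (card (sm m)) \<le> K ^ card (sm n)" using K(1) by (intro power_increasing) auto
        moreover have "real k + 1 \<le> K * real p powr (\<eta> * real k)"
        proof -
          have "2 powr (\<eta> * real k) \<le> real p powr (\<eta> * real k)"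
            using p2 assms by (intro powr_mono2) auto
          then show ?thesis using K(2)[of k] K(1)
            by (meson mult_left_mono order_trans zero_le_one)
        qed
        then have "(real k + 1) * K ^ card (sm m) \<le> (K * real p powr (\<eta> * real k)) * K ^ card (sm m)"
          using K(1) by (intro mult_right_mono) auto
        moreover have "K ^ Suc (card (sm m)) * real p powr (\<eta> * real k) \<le> K ^ card (sm n) * real p powr (\<eta> * real k)"
          using calculation(1) by (intro mult_right_mono) auto
        ultimately show ?thesis by (simp add: mult_ac)
      next
        case False
        then have "2 powr (1 / \<eta>) \<le> real p" unfolding P_def by linarith
        then have "(2 powr (1 / \<eta>)) powr \<eta> \<le> real p powr \<eta>"
          using assms by (intro powr_mono2) auto
        then have "2 \<le> real p powr \<eta>" using assms by (simp add: powr_powr)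
        then have "2 ^ k \<le> (real p powr \<eta>) ^ k" by (intro power_mono) auto
        also have "\<dots> = real p powr (\<eta> * real k)" using p2 by (simp add: powr_powr flip: powr_realpow)
        finally have "2 ^ k \<le> real p powr (\<eta> * real k)" .
        moreover have "real k + 1 \<le> 2 ^ k"
        proof -
          have "Suc k \<le> 2 ^ k" by (simp add: Suc_leI less_exp)
          then have "real (Suc k) \<le> real (2 ^ k)" by (rule of_nat_mono)
          then show ?thesis by simp
        qed
        ultimately have "real k + 1 \<le> real p powr (\<eta> * real k)" by linarith
        moreover have "K ^ card (sm m) \<le> K ^ card (sm n)"
          using K(1) sub fin by (intro power_increasing card_mono) auto
        ultimately have "(real k + 1) * K ^ card (sm m) \<le> real p powr (\<eta> * real k) * K ^ card (sm n)"
          using K(1) by (intro mult_mono) auto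
        then show ?thesis by (simp add: mult_ac)
      qed
      have "real (card {d. d dvd n}) \<le> (real k + 1) * real (card {d. d dvd m})"
        using card_divisors_prime_power_mult[OF p(1) m0, of k] unfolding n
        by (metis Suc_eq_plus1 of_nat_Suc of_nat_le_iff of_nat_mult add.commute)
      also have "\<dots> \<le> (real k + 1) * (K ^ card (sm m) * real m powr \<eta>)"
        using IH by (intro mult_left_mono) auto
      also have "\<dots> = ((real k + 1) * K ^ card (sm m)) * real m powr \<eta>" by simp
      also have "\<dots> \<le> (K ^ card (sm n) * real p powr (\<eta> * real k)) * real m powr \<eta>"
        using step by (intro mult_right_mono) auto
      also have "\<dots> = K ^ card (sm n) * real n powr \<eta>"
        using p2 by (simp add: n powr_mult powr_powr mult_ac flip: powr_realpow)
      finally show ?thesis .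
    qed
  qed
  show ?thesis
  proof
    show "K ^ P \<ge> 1" using K(1) by (simp add: one_le_power)
    fix n :: nat assume "n > 0"
    have "card (sm n) \<le> card {..<P}" unfolding sm_def by (intro card_mono) auto
    then have "K ^ card (sm n) \<le> K ^ P" using K(1) by (intro power_increasing) auto
    then have "K ^ card (sm n) * real n powr \<eta> \<le> K ^ P * real n powr \<eta>"
      by (intro mult_right_mono) auto
    with main[OF \<open>n > 0\<close>] show "real (card {d. d dvd n}) \<le> K ^ P * real n powr \<eta>" by linarith
  qed
qed

subsection \<open>Counting near coincidences\<close>

text \<open>On either side of \<open>- \<theta>\<close> the successive integers lie at distances at
  least 0, 1, 2, ..., and a natural number is at most its square. Two geometric series therefore
  bound the sum, uniformly in \<open>\<theta>\<close> and \<open>A\<close>.\<close>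

lemma sum_exp_neg_square_shift_bound:
  fixes \<kappa> :: real
  assumes "\<kappa> > 0"
  obtains C where "C \<ge> 1"
    "\<And>(A :: int set) \<theta>. finite A \<Longrightarrow> (\<Sum>n\<in>A. exp (- \<kappa> * (of_int n + \<theta>)\<^sup>2)) \<le> C"
proof -
  define g where "g k = exp (- \<kappa> * real k)" for k :: nat
  have g_eq: "g k = exp (- \<kappa>) ^ k" for k by (simp add: g_def mult.commute flip: exp_of_nat_mult)
  have smm: "summable g" unfolding g_eq using assms by (intro summable_geometric) auto
  define S where "S = suminf g"
  have le: "(\<Sum>k\<in>B. g k) \<le> S" if "finite B" for B
    unfolding S_def by (intro sum_le_suminf smm that) (auto simp: g_def)
  have half: "(\<Sum>n\<in>A. exp (- \<kappa> * (of_int n + \<theta>)\<^sup>2)) \<le> S"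
    if "finite A" "inj_on h A" "\<And>n. n \<in> A \<Longrightarrow> \<bar>of_int n + \<theta>\<bar> \<ge> real (h n)"
    for A :: "int set" and \<theta> h
  proof -
    have "(\<Sum>n\<in>A. exp (- \<kappa> * (of_int n + \<theta>)\<^sup>2)) \<le> (\<Sum>n\<in>A. g (h n))"
    proof (rule sum_mono)
      fix n assume "n \<in> A"
      have "real (h n) \<le> (real (h n))\<^sup>2"
        by (cases "h n") (auto simp: power2_eq_square)
      also have "\<dots> \<le> (of_int n + \<theta>)\<^sup>2"
        using that(3)[OF \<open>n \<in> A\<close>] by (metis abs_le_square_iff abs_of_nat)
      finally show "exp (- \<kappa> * (of_int n + \<theta>)\<^sup>2) \<le> g (h n)" using assms by (simp add: g_def)
    qed
    also have "\<dots> = (\<Sum>k\<in>h ` A. g k)" using that by (simp add: sum.reindex)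
    also have "\<dots> \<le> S" using that by (intro le) auto
    finally show ?thesis .
  qed
  show ?thesis
  proof
    show "max 1 (2 * S) \<ge> 1" by simp
    fix A :: "int set" and \<theta> :: real
    assume fin: "finite A"
    define m where "m = \<lceil>- \<theta>\<rceil>"
    let ?A = "{n \<in> A. n \<ge> m}" and ?B = "{n \<in> A. n < m}"
    have "(\<Sum>n\<in>A. exp (- \<kappa> * (of_int n + \<theta>)\<^sup>2)) =
          (\<Sum>n\<in>?A \<union> ?B. exp (- \<kappa> * (of_int n + \<theta>)\<^sup>2))"
      by (rule sum.cong) auto
    also have "\<dots> = (\<Sum>n\<in>?A. exp (- \<kappa> * (of_int n + \<theta>)\<^sup>2)) + (\<Sum>n\<in>?B. exp (- \<kappa> * (of_int n + \<theta>)\<^sup>2))"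
      using fin by (intro sum.union_disjoint) auto
    also have "(\<Sum>n\<in>?A. exp (- \<kappa> * (of_int n + \<theta>)\<^sup>2)) \<le> S"
    proof (rule half[where h = "\<lambda>n. nat (n - m)"])
      fix n assume "n \<in> ?A"
      moreover have "- \<theta> \<le> of_int m" by (simp add: m_def)
      ultimately have "real (nat (n - m)) \<le> of_int n + \<theta>" by simp
      then show "real (nat (n - m)) \<le> \<bar>of_int n + \<theta>\<bar>" by linarith
    qed (use fin in \<open>auto simp: inj_on_def\<close>)
    also have "(\<Sum>n\<in>?B. exp (- \<kappa> * (of_int n + \<theta>)\<^sup>2)) \<le> S"
    proof (rule half[where h = "\<lambda>n. nat (m - 1 - n)"])
      fix n assume "n \<in> ?B"
      moreover have "of_int m < - \<theta> + 1" unfolding m_def by linarith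
      ultimately have "real (nat (m - 1 - n)) \<le> - (of_int n + \<theta>)" by simp
      then show "real (nat (m - 1 - n)) \<le> \<bar>of_int n + \<theta>\<bar>" by linarith
    qed (use fin in \<open>auto simp: inj_on_def\<close>)
    finally show "(\<Sum>n\<in>A. exp (- \<kappa> * (of_int n + \<theta>)\<^sup>2)) \<le> max 1 (2 * S)" by simp
  qed
qed

text \<open>Grouping by the value of \<open>f\<close> gives this. Below, \<open>f\<close> is a
  product and its fibers inject into sets of divisors, so \<open>D\<close> comes from the divisor
  bound.\<close>

lemma sum_comp_le_fiber_bound:
  fixes \<phi> :: "'b \<Rightarrow> real" and D :: real
  assumes "finite A" "finite B" "f ` A \<subseteq> B"
    and "\<And>y. y \<in> B \<Longrightarrow> real (card {x \<in> A. f x = y}) \<le> D"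
    and "\<And>y. y \<in> B \<Longrightarrow> \<phi> y \<ge> 0"
  shows "(\<Sum>x\<in>A. \<phi> (f x)) \<le> D * (\<Sum>y\<in>B. \<phi> y)"
proof -
  have "(\<Sum>x\<in>A. \<phi> (f x)) = (\<Sum>y\<in>B. \<Sum>x | x \<in> A \<and> f x = y. \<phi> (f x))"
    using sum.group[OF assms(1-3), of "\<lambda>x. \<phi> (f x)"] by simp
  also have "\<dots> = (\<Sum>y\<in>B. real (card {x \<in> A. f x = y}) * \<phi> y)"
    by (intro sum.cong) auto
  also have "\<dots> \<le> (\<Sum>y\<in>B. D * \<phi> y)"
    using assms(4,5) by (intro sum_mono mult_right_mono) auto
  finally show ?thesis by (simp add: sum_distrib_left)
qed

text \<open>The substitution \<open>h = u - v\<close> turns \<open>u (s + \<beta>) - v (s' + \<beta>)\<close> into the integer \<open>u (s - s')\<close> plus a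
  shift that depends only on \<open>h\<close> and \<open>s'\<close>; each nonzero integer is of the form \<open>u (s - s')\<close> in at
  most \<open>D\<close> ways.\<close>

lemma sum_exp_collision_bound:
  fixes \<kappa> \<beta> C D :: real and U M :: nat
  assumes \<kappa>: "\<kappa> > 0" and \<beta>: "real M + \<beta> \<ge> 0" and U: "U \<ge> 1"
    and C: "\<And>(A :: int set) \<theta>. finite A \<Longrightarrow> (\<Sum>n\<in>A. exp (- \<kappa> * (of_int n + \<theta>)\<^sup>2)) \<le> C"
    and D: "\<And>n::nat. 1 \<le> n \<Longrightarrow> n \<le> U * M \<Longrightarrow> real (card {d. d dvd n}) \<le> D" "D \<ge> 1"
  shows "(\<Sum>s\<in>{M<..2*M}. \<Sum>s'\<in>{M<..2*M}. \<Sum>u\<in>{1..U}. \<Sum>v\<in>{1..U}.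
            exp (- \<kappa> * (real u * (real s + \<beta>) - real v * (real s' + \<beta>))\<^sup>2)) \<le> 4 * C * D * real U * real M"
proof -
  define E where "E t = exp (- \<kappa> * t\<^sup>2)" for t
  have E0: "E t \<ge> 0" for t by (simp add: E_def)
  have C': "(\<Sum>n\<in>A. E (of_int n + \<theta>)) \<le> C" if "finite A" for A :: "int set" and \<theta>
    using C[OF that, of \<theta>] by (simp add: E_def)
  have C0: "C \<ge> 0" using C[of "{}" 0] by simp
  let ?S = "{M<..2*M}" and ?H = "{-int U..int U}"
  define T where "T h s' u s = E (of_int (int u * (int s - int s')) + of_int h * (real s' + \<beta>))" for h s' u s
  \<comment> \<open>For fixed \<open>u\<close> the values \<open>h = u - v\<close> are distinct.
    Since all terms are nonnegative, \<open>h\<close> may range over all of \<open>?H\<close>, which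
    no longer depends on \<open>u\<close>, so the sums can be interchanged.\<close>
  have diff: "(\<Sum>v\<in>{1..U}. E (real u * (real s + \<beta>) - real v * (real s' + \<beta>))) \<le> (\<Sum>h\<in>?H. T h s' u s)"
    if "u \<in> {1..U}" for u s s'
  proof -
    have "(\<Sum>v\<in>{1..U}. E (real u * (real s + \<beta>) - real v * (real s' + \<beta>)))
        = (\<Sum>v\<in>{1..U}. T (int u - int v) s' u s)"
      unfolding T_def by (intro sum.cong arg_cong[where f = E]) (auto simp: algebra_simps)
    also have "\<dots> = (\<Sum>h\<in>(\<lambda>v. int u - int v) ` {1..U}. T h s' u s)"
      by (subst sum.reindex) (auto simp: inj_on_def)
    also have "\<dots> \<le> (\<Sum>h\<in>?H. T h s' u s)"
      using that by (intro sum_mono2) (auto simp: T_def E0)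
    finally show ?thesis .
  qed
  \<comment> \<open>For \<open>s \<noteq> s'\<close> the integer \<open>u * (s - s')\<close> is
    nonzero and at most \<open>U * M\<close> in absolute value. In a fiber, \<open>u\<close> is a
    divisor of it and determines \<open>s\<close>.\<close>
  have off: "(\<Sum>s\<in>?S - {s'}. \<Sum>u\<in>{1..U}. T h s' u s) \<le> D * C" if s': "s' \<in> ?S" for s' h
  proof -
    let ?A = "(?S - {s'}) \<times> {1..U}" and ?f = "\<lambda>(s, u). int u * (int s - int s')"
    let ?B = "{-int (U * M)..int (U * M)} - {0}"
    have "(\<Sum>s\<in>?S - {s'}. \<Sum>u\<in>{1..U}. T h s' u s)
        = (\<Sum>x\<in>?A. E (of_int (?f x) + of_int h * (real s' + \<beta>)))"
      unfolding T_def by (subst sum.cartesian_product) (auto intro!: sum.cong)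
    also have "\<dots> \<le> D * (\<Sum>n\<in>?B. E (of_int n + of_int h * (real s' + \<beta>)))"
    proof (rule sum_comp_le_fiber_bound)
      show "?f ` ?A \<subseteq> ?B"
      proof (rule image_subsetI)
        fix x assume "x \<in> ?A"
        then obtain s u where x: "x = (s, u)" and "s \<in> ?S" "s \<noteq> s'" "u \<in> {1..U}" by blast
        then have "\<bar>int s - int s'\<bar> \<le> int M" using s' by auto
        then have "\<bar>int u * (int s - int s')\<bar> \<le> int U * int M"
          unfolding abs_mult using \<open>u \<in> {1..U}\<close> by (intro mult_mono) auto
        then show "?f x \<in> ?B"
          using \<open>s \<noteq> s'\<close> \<open>u \<in> {1..U}\<close> by (auto simp: x)
      qed
      fix n assume n: "n \<in> ?B"
      have "card {x \<in> ?A. ?f x = n} \<le> card {d. d dvd nat \<bar>n\<bar>}"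
      proof (rule card_inj_on_le)
        show "inj_on snd {x \<in> ?A. ?f x = n}" by (auto simp: inj_on_def)
        show "snd ` {x \<in> ?A. ?f x = n} \<subseteq> {d. d dvd nat \<bar>n\<bar>}"
          by (auto simp: nat_abs_mult_distrib)
        have "nat \<bar>n\<bar> > 0" using n by simp
        then show "finite {d. d dvd nat \<bar>n\<bar>}" by (rule finite_divisors_nat)
      qed
      also have "real (card {d. d dvd nat \<bar>n\<bar>}) \<le> D"
      proof (intro D(1))
        have "\<bar>n\<bar> \<le> int (U * M)" using n by (simp add: abs_le_iff)
        then show "nat \<bar>n\<bar> \<le> U * M" by (simp only: nat_le_iff)
        show "1 \<le> nat \<bar>n\<bar>" using n by auto
      qed
      finally show "real (card {x \<in> ?A. ?f x = n}) \<le> D" by simp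
    qed (auto simp: E0)
    also have "\<dots> \<le> D * C" using D(2) by (intro mult_left_mono C') auto
    finally show ?thesis .
  qed
  \<comment> \<open>For \<open>s = s'\<close> the integer part vanishes and only
    \<open>h * (s' + \<beta>)\<close> is left. As \<open>s' > M\<close> gives
    \<open>s' + \<beta> \<ge> 1\<close>, the sum over \<open>h\<close> is at most \<open>C\<close>,
    while \<open>u\<close> is free.\<close>
  have diag: "(\<Sum>h\<in>?H. \<Sum>u\<in>{1..U}. T h s' u s') \<le> real U * C" if s': "s' \<in> ?S" for s'
  proof -
    have "E (of_int h * (real s' + \<beta>)) \<le> E (of_int h + 0)" for h :: int
    proof -
      have "1 \<le> real s' + \<beta>" using s' \<beta> by auto
      then have "\<bar>of_int h :: real\<bar> * 1 \<le> \<bar>of_int h\<bar> * \<bar>real s' + \<beta>\<bar>" by (intro mult_left_mono) auto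
      then have "(of_int h)\<^sup>2 \<le> (of_int h * (real s' + \<beta>))\<^sup>2"
        by (metis abs_le_square_iff abs_mult mult.right_neutral)
      then show ?thesis using \<kappa> by (simp add: E_def)
    qed
    then have "(\<Sum>h\<in>?H. \<Sum>u\<in>{1..U}. T h s' u s') \<le> (\<Sum>h\<in>?H. \<Sum>u\<in>{1..U}. E (of_int h + 0))"
      unfolding T_def by (intro sum_mono) simp
    also have "\<dots> = real U * (\<Sum>h\<in>?H. E (of_int h + 0))" by (simp add: sum_distrib_left)
    also have "\<dots> \<le> real U * C" by (intro mult_left_mono C') auto
    finally show ?thesis .
  qed
  have "(\<Sum>s\<in>?S. \<Sum>s'\<in>?S. \<Sum>u\<in>{1..U}. \<Sum>v\<in>{1..U}. E (real u * (real s + \<beta>) - real v * (real s' + \<beta>)))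
      \<le> (\<Sum>s\<in>?S. \<Sum>s'\<in>?S. \<Sum>u\<in>{1..U}. \<Sum>h\<in>?H. T h s' u s)"
    by (intro sum_mono diff)
  also have "\<dots> = (\<Sum>s'\<in>?S. \<Sum>s\<in>?S. \<Sum>h\<in>?H. \<Sum>u\<in>{1..U}. T h s' u s)"
    by (subst sum.swap) (intro sum.cong refl sum.swap)
  also have "\<dots> = (\<Sum>s'\<in>?S. \<Sum>h\<in>?H. \<Sum>s\<in>?S. \<Sum>u\<in>{1..U}. T h s' u s)"
    by (intro sum.cong refl sum.swap)
  also have "\<dots> = (\<Sum>s'\<in>?S. \<Sum>h\<in>?H. (\<Sum>u\<in>{1..U}. T h s' u s') + (\<Sum>s\<in>?S - {s'}. \<Sum>u\<in>{1..U}. T h s' u s))"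
    by (intro sum.cong refl sum.remove) auto
  also have "\<dots> = (\<Sum>s'\<in>?S. (\<Sum>h\<in>?H. \<Sum>u\<in>{1..U}. T h s' u s') + (\<Sum>h\<in>?H. \<Sum>s\<in>?S - {s'}. \<Sum>u\<in>{1..U}. T h s' u s))"
    by (simp add: sum.distrib)
  also have "\<dots> \<le> (\<Sum>s'\<in>?S. real U * C + (\<Sum>h\<in>?H. D * C))"
    by (intro sum_mono add_mono diag off)
  also have "\<dots> = real M * (real U * C + (2 * real U + 1) * (D * C))" by simp
  \<comment> \<open>With \<open>2 * U + 1 \<le> 3 * U\<close> the diagonal and off-diagonal parts
    add up to the factor 4.\<close>
  also have "\<dots> \<le> real M * (real U * (D * C) + (3 * real U) * (D * C))"
  proof (intro mult_left_mono add_mono mult_right_mono)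
    show "C \<le> D * C" using D(2) C0 by (simp add: mult_le_cancel_right1)
  qed (use U D(2) C0 in auto)
  finally show ?thesis by (simp add: E_def algebra_simps)
qed

text \<open>Only the products \<open>u = j * d\<close> and \<open>v = l * d'\<close> matter, and
  each value arises at most \<open>D\<close> times. This costs \<open>D\<^sup>2\<close>; the third
  \<open>D\<close> and the rest come from the collision bound with \<open>U = J * M\<close>.\<close>

lemma sum_exp_frequency_bound:
  fixes \<kappa> \<beta> C D :: real and J M :: nat
  assumes \<kappa>: "\<kappa> > 0" and \<beta>: "real M + \<beta> \<ge> 0" and J: "J \<ge> 1" and M: "M \<ge> 1"
    and C: "\<And>(A :: int set) \<theta>. finite A \<Longrightarrow> (\<Sum>n\<in>A. exp (- \<kappa> * (of_int n + \<theta>)\<^sup>2)) \<le> C"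
    and D: "\<And>n::nat. 1 \<le> n \<Longrightarrow> n \<le> J * M * M \<Longrightarrow> real (card {d. d dvd n}) \<le> D" "D \<ge> 1"
  shows "(\<Sum>(s, j, d)\<in>{M<..2*M} \<times> {1..J} \<times> {1..M}. \<Sum>(s', l, d')\<in>{M<..2*M} \<times> {1..J} \<times> {1..M}.
            exp (- \<kappa> * (real (j * d) * (real s + \<beta>) - real (l * d') * (real s' + \<beta>))\<^sup>2))
          \<le> 4 * C * D ^ 3 * real J * (real M)\<^sup>2"
proof -
  let ?S = "{M<..2*M}" and ?P = "{1..J} \<times> {1..M}"
  define E where "E s s' u v = exp (- \<kappa> * (real u * (real s + \<beta>) - real v * (real s' + \<beta>))\<^sup>2)" for s s' u v
  have E0: "E s s' u v \<ge> 0" for s s' u v by (simp add: E_def)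
  have red: "(\<Sum>(j, d)\<in>?P. \<phi> (j * d)) \<le> D * (\<Sum>u\<in>{1..J*M}. \<phi> u)" if "\<And>u. \<phi> u \<ge> 0" for \<phi> :: "nat \<Rightarrow> real"
  proof -
    have "(\<Sum>x\<in>?P. \<phi> ((\<lambda>(j, d). j * d) x)) \<le> D * (\<Sum>u\<in>{1..J*M}. \<phi> u)"
    proof (rule sum_comp_le_fiber_bound)
      show "(\<lambda>(j, d). j * d) ` ?P \<subseteq> {1..J*M}" by (auto intro!: mult_le_mono)
      fix u assume u: "u \<in> {1..J*M}"
      have "card {x \<in> ?P. (case x of (j, d) \<Rightarrow> j * d) = u} \<le> card {d. d dvd u}"
      proof (rule card_inj_on_le)
        show "inj_on fst {x \<in> ?P. (case x of (j, d) \<Rightarrow> j * d) = u}" by (auto simp: inj_on_def)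
        show "fst ` {x \<in> ?P. (case x of (j, d) \<Rightarrow> j * d) = u} \<subseteq> {d. d dvd u}" by auto
        show "finite {d. d dvd u}" using u by auto
      qed
      also have "real (card {d. d dvd u}) \<le> D"
      proof (intro D)
        have "u * 1 \<le> (J * M) * M" using u M by (intro mult_le_mono) auto
        then show "u \<le> J * M * M" by simp
      qed (use u in auto)
      finally show "real (card {x \<in> ?P. (case x of (j, d) \<Rightarrow> j * d) = u}) \<le> D" by simp
    qed (auto simp: that)
    then show ?thesis by (simp add: case_prod_unfold)
  qed
  have split: "(\<Sum>(s, j, d)\<in>?S \<times> ?P. h s (j * d)) = (\<Sum>s\<in>?S. \<Sum>(j, d)\<in>?P. h s (j * d))"
    for h :: "nat \<Rightarrow> nat \<Rightarrow> real"
    by (simp add: sum.cartesian_product case_prod_unfold)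
  have "(\<Sum>(s, j, d)\<in>?S \<times> ?P. \<Sum>(s', l, d')\<in>?S \<times> ?P. E s s' (j * d) (l * d'))
      = (\<Sum>s\<in>?S. \<Sum>(j, d)\<in>?P. \<Sum>s'\<in>?S. \<Sum>(l, d')\<in>?P. E s s' (j * d) (l * d'))"
    by (subst split[where h = "\<lambda>s u. \<Sum>(s', l, d')\<in>?S \<times> ?P. E s s' u (l * d')"], subst split) (rule refl)
  also have "\<dots> = (\<Sum>s\<in>?S. \<Sum>s'\<in>?S. \<Sum>(j, d)\<in>?P. \<Sum>(l, d')\<in>?P. E s s' (j * d) (l * d'))"
    unfolding case_prod_unfold by (intro sum.cong refl sum.swap)
  also have "\<dots> \<le> (\<Sum>s\<in>?S. \<Sum>s'\<in>?S. D * (\<Sum>u\<in>{1..J*M}. D * (\<Sum>v\<in>{1..J*M}. E s s' u v)))"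
  proof (intro sum_mono)
    fix s s'
    have "(\<Sum>(j, d)\<in>?P. \<Sum>(l, d')\<in>?P. E s s' (j * d) (l * d')) \<le> (\<Sum>(j, d)\<in>?P. D * (\<Sum>v\<in>{1..J*M}. E s s' (j * d) v))"
      using red[of "\<lambda>v. E s s' u v" for u] by (intro sum_mono) (auto simp: E0)
    also have "\<dots> \<le> D * (\<Sum>u\<in>{1..J*M}. D * (\<Sum>v\<in>{1..J*M}. E s s' u v))"
      using D(2) by (intro red) (auto intro!: mult_nonneg_nonneg sum_nonneg E0)
    finally show "(\<Sum>(j, d)\<in>?P. \<Sum>(l, d')\<in>?P. E s s' (j * d) (l * d')) \<le> D * (\<Sum>u\<in>{1..J*M}. D * (\<Sum>v\<in>{1..J*M}. E s s' u v))" .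
  qed
  also have "\<dots> = D\<^sup>2 * (\<Sum>s\<in>?S. \<Sum>s'\<in>?S. \<Sum>u\<in>{1..J*M}. \<Sum>v\<in>{1..J*M}. E s s' u v)"
    by (simp add: sum_distrib_left power2_eq_square mult.assoc)
  also have "\<dots> \<le> D\<^sup>2 * (4 * C * D * real (J * M) * real M)"
    unfolding E_def using J M by (intro mult_left_mono sum_exp_collision_bound \<kappa> \<beta> C D) auto
  also have "\<dots> = 4 * C * D ^ 3 * real J * (real M)\<^sup>2" by (simp add: power2_eq_square power3_eq_cube)
  finally show ?thesis by (simp add: E_def)
qed

subsection \<open>A trigonometric minorant\<close>

text \<open>The coefficients are the autocorrelations of \<open>b\<close>; the factor 2 merges the
  frequencies \<open>j\<close> and \<open>-j\<close>. The induction adds the top term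
  \<open>b m * z ^ m\<close> and its cross terms with the earlier ones.\<close>

lemma norm_cis_sum_power2:
  fixes b :: "nat \<Rightarrow> real"
  shows "(norm (\<Sum>k<m. of_real (b k) * cis \<theta> ^ k))\<^sup>2 =
         (\<Sum>j<m. ((if j = 0 then 1 else 2) * (\<Sum>k<m-j. b k * b (k + j))) * cos (real j * \<theta>))"
proof -
  have re: "Re (\<Sum>k<m. of_real (b k) * cis \<theta> ^ k) = (\<Sum>k<m. b k * cos (real k * \<theta>))" for m
    by (simp add: Complex.DeMoivre)
  have im: "Im (\<Sum>k<m. of_real (b k) * cis \<theta> ^ k) = (\<Sum>k<m. b k * sin (real k * \<theta>))" for m
    by (simp add: Complex.DeMoivre)
  define w :: "nat \<Rightarrow> real" where "w j = (if j = 0 then 1 else 2)" for j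
  have "(\<Sum>k<m. b k * cos (real k * \<theta>))\<^sup>2 + (\<Sum>k<m. b k * sin (real k * \<theta>))\<^sup>2 =
         (\<Sum>j<m. (w j * (\<Sum>k<m-j. b k * b (k + j))) * cos (real j * \<theta>))"
  proof (induction m)
    case (Suc m)
    let ?X = "\<Sum>k<m. b k * cos (real k * \<theta>)" and ?Y = "\<Sum>k<m. b k * sin (real k * \<theta>)"
    have cross: "?X * cos (real m * \<theta>) + ?Y * sin (real m * \<theta>) = (\<Sum>k<m. b k * cos (real (m - k) * \<theta>))"
      unfolding sum_distrib_right sum.distrib[symmetric]
      by (intro sum.cong) (auto simp: of_nat_diff left_diff_distrib cos_diff algebra_simps)
    \<comment> \<open>Each inner sum gains exactly the term \<open>k = m - j\<close>.\<close>
    have "(\<Sum>j<Suc m. (w j * (\<Sum>k<Suc m-j. b k * b (k + j))) * cos (real j * \<theta>))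
        = (\<Sum>j<Suc m. (w j * (\<Sum>k<m-j. b k * b (k + j))) * cos (real j * \<theta>))
          + (\<Sum>j<Suc m. w j * (b (m - j) * b m) * cos (real j * \<theta>))"
      unfolding sum.distrib[symmetric]
      by (intro sum.cong refl) (auto simp: Suc_diff_le algebra_simps less_Suc_eq_le)
    also have "(\<Sum>j<Suc m. (w j * (\<Sum>k<m-j. b k * b (k + j))) * cos (real j * \<theta>)) =
               (\<Sum>j<m. (w j * (\<Sum>k<m-j. b k * b (k + j))) * cos (real j * \<theta>))"
      by simp
    \<comment> \<open>The new terms consist of the square (\<open>j = 0\<close>) and, after
      reflecting the index, the cross terms of \<open>cross\<close>.\<close>
    also have "(\<Sum>j<Suc m. w j * (b (m - j) * b m) * cos (real j * \<theta>))
        = (b m)\<^sup>2 + (\<Sum>j<m. 2 * (b (m - Suc j) * b m) * cos (real (Suc j) * \<theta>))"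
      by (subst sum.lessThan_Suc_shift) (simp add: w_def power2_eq_square)
    also have "(\<Sum>j<m. 2 * (b (m - Suc j) * b m) * cos (real (Suc j) * \<theta>))
        = (\<Sum>j<m. 2 * (b (m - Suc j) * b m) * cos (real (m - (m - Suc j)) * \<theta>))"
      by (intro sum.cong refl) (simp add: Suc_diff_le)
    also have "\<dots> = (\<Sum>k<m. 2 * (b k * b m) * cos (real (m - k) * \<theta>))"
      by (rule sum.nat_diff_reindex[where g = "\<lambda>k. 2 * (b k * b m) * cos (real (m - k) * \<theta>)"])
    also have "\<dots> = 2 * b m * (\<Sum>k<m. b k * cos (real (m - k) * \<theta>))"
      by (simp add: sum_distrib_left mult_ac)
    finally have "(\<Sum>j<Suc m. (w j * (\<Sum>k<Suc m-j. b k * b (k + j))) * cos (real j * \<theta>))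
       = ?X\<^sup>2 + ?Y\<^sup>2 + ((b m)\<^sup>2 + 2 * b m * (?X * cos (real m * \<theta>) + ?Y * sin (real m * \<theta>)))"
      by (simp only: Suc.IH cross)
    also have "\<dots> = (?X + b m * cos (real m * \<theta>))\<^sup>2 + (?Y + b m * sin (real m * \<theta>))\<^sup>2"
    proof -
      have "X\<^sup>2 + Y\<^sup>2 + (r\<^sup>2 + 2 * r * (X * c + Y * s)) = (X + r * c)\<^sup>2 + (Y + r * s)\<^sup>2"
        if "c\<^sup>2 + s\<^sup>2 = 1" for X Y r c s :: real
        using that by algebra
      then show ?thesis by simp
    qed
    finally show ?case by simp
  qed simp
  then show ?thesis by (simp add: cmod_power2 re im w_def del: Re_sum Im_sum)
qed

text \<open>By the arithmetic-geometric mean inequality, as both index windows lie in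
  \<open>{..<m}\<close>. It controls every coefficient of the minorant by the coefficient at
  0.\<close>

lemma autocorrelation_bound:
  fixes b :: "nat \<Rightarrow> real"
  shows "\<bar>\<Sum>k<m-j. b k * b (k + j)\<bar> \<le> (\<Sum>k<m. (b k)\<^sup>2)"
proof -
  have amgm: "\<bar>x * y\<bar> \<le> x\<^sup>2 / 2 + y\<^sup>2 / 2" for x y :: real
    using sum_squares_bound[of "\<bar>x\<bar>" "\<bar>y\<bar>"] by (simp add: abs_mult)
  have "\<bar>\<Sum>k<m-j. b k * b (k + j)\<bar> \<le> (\<Sum>k<m-j. (b k)\<^sup>2 / 2 + (b (k + j))\<^sup>2 / 2)"
    by (rule order_trans[OF sum_abs]) (intro sum_mono amgm)
  also have "\<dots> = (\<Sum>k<m-j. (b k)\<^sup>2) / 2 + (\<Sum>k<m-j. (b (k + j))\<^sup>2) / 2"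
    by (simp add: sum.distrib sum_divide_distrib)
  also have "(\<Sum>k<m-j. (b (k + j))\<^sup>2) = (\<Sum>k\<in>(\<lambda>k. k + j) ` {..<m-j}. (b k)\<^sup>2)"
    by (subst sum.reindex) auto
  also have "(\<Sum>k\<in>(\<lambda>k. k + j) ` {..<m-j}. (b k)\<^sup>2) \<le> (\<Sum>k<m. (b k)\<^sup>2)"
    by (intro sum_mono2) auto
  also have "(\<Sum>k<m-j. (b k)\<^sup>2) \<le> (\<Sum>k<m. (b k)\<^sup>2)"
    by (intro sum_mono2) auto
  finally show ?thesis by simp
qed

text \<open>Summation by parts: as \<open>b\<close> vanishes at both ends, \<open>z\<close> times
  the polynomial of the differences is \<open>1 - z\<close> times the polynomial of
  \<open>b\<close>.\<close>

lemma norm_difference_cis_sum: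
  fixes b :: "nat \<Rightarrow> real" and z :: complex
  assumes "b 0 = 0" "b m = 0" "norm z = 1"
  shows "norm (\<Sum>k<m. of_real (b (Suc k) - b k) * z ^ k) = norm (1 - z) * norm (\<Sum>k<m. of_real (b k) * z ^ k)"
proof -
  have "z * (\<Sum>k<m. of_real (b (Suc k) - b k) * z ^ k)
      = (\<Sum>k<m. of_real (b (Suc k)) * z ^ Suc k) - z * (\<Sum>k<m. of_real (b k) * z ^ k)"
    unfolding sum_distrib_left sum_subtractf[symmetric]
    by (intro sum.cong) (simp_all add: algebra_simps)
  also have "(\<Sum>k<m. of_real (b (Suc k)) * z ^ Suc k) = (\<Sum>k<Suc m. of_real (b k) * z ^ k)"
    by (subst sum.lessThan_Suc_shift) (simp add: assms)
  also have "\<dots> = (\<Sum>k<m. of_real (b k) * z ^ k)" by (simp add: assms)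
  finally have "z * (\<Sum>k<m. of_real (b (Suc k) - b k) * z ^ k) = (1 - z) * (\<Sum>k<m. of_real (b k) * z ^ k)"
    by (simp add: algebra_simps)
  then have "norm (z * (\<Sum>k<m. of_real (b (Suc k) - b k) * z ^ k)) = norm ((1 - z) * (\<Sum>k<m. of_real (b k) * z ^ k))"
    by (rule arg_cong)
  then show ?thesis by (simp only: norm_mult assms mult_1)
qed

text \<open>A crude Jordan inequality: the cubic Taylor remainder is at most
  \<open>\<bar>y\<bar> / 2\<close> because \<open>y\<^sup>2 \<le> 3\<close> in this range.\<close>

lemma abs_sin_ge_half:
  fixes y :: real
  assumes "\<bar>y\<bar> \<le> pi / 2"
  shows "\<bar>sin y\<bar> \<ge> \<bar>y\<bar> / 2"
proof -
  have "\<bar>sin y - y\<bar> \<le> \<bar>y\<bar> ^ 3 / 6"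
    using Maclaurin_sin_bound[of y 3] by (simp add: sin_coeff_def eval_nat_numeral)
  moreover have "\<bar>y\<bar> ^ 3 / 6 \<le> \<bar>y\<bar> / 2"
  proof -
    have "\<bar>y\<bar> \<le> 1.7" using assms pi_approx(2) by simp
    then have "\<bar>y\<bar> * \<bar>y\<bar> \<le> 1.7 * 1.7" by (intro mult_mono) auto
    then have "\<bar>y\<bar> * (\<bar>y\<bar> * \<bar>y\<bar>) \<le> \<bar>y\<bar> * 3" by (intro mult_left_mono) auto
    then show ?thesis by (simp add: power3_eq_cube mult.assoc)
  qed
  ultimately show ?thesis by linarith
qed

text \<open>With \<open>y\<close> the signed distance to a nearest integer, the left side is
  \<open>4 * (sin (pi * y))\<^sup>2\<close>, hence at least \<open>pi\<^sup>2 * y\<^sup>2\<close>;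
  the 9 is \<open>3\<^sup>2 \<le> pi\<^sup>2\<close>.\<close>

lemma norm_one_minus_cis_ge:
  assumes "dist_int x \<ge> r" "r \<ge> 0"
  shows "(norm (1 - cis (2 * pi * x)))\<^sup>2 \<ge> 9 * r\<^sup>2"
proof -
  define y where "y = x - of_int (round x)"
  have "dist_int x \<le> \<bar>y\<bar>" unfolding dist_int_def y_def
    by (intro cINF_lower bdd_belowI[of _ 0]) auto
  with assms have yr: "\<bar>y\<bar> \<ge> r" by simp
  have y2: "\<bar>y\<bar> \<le> 1 / 2" unfolding y_def using of_int_round_abs_le[of x] by (simp add: abs_minus_commute)
  have "(norm (1 - cis (2 * pi * x)))\<^sup>2 = 2 - 2 * cos (2 * pi * x)"
    using sin_cos_squared_add[of "2 * pi * x"]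
    by (simp add: cmod_power2 power2_diff algebra_simps)
  also have "cos (2 * pi * x) = cos (2 * (pi * y))"
    using cos_int_2pin[of "round x"] sin_int_2pin[of "round x"]
    by (simp add: y_def right_diff_distrib cos_diff mult_ac)
  also have "2 - 2 * cos (2 * (pi * y)) = 4 * (sin (pi * y))\<^sup>2" by (simp add: cos_double_sin)
  also have "\<dots> \<ge> 4 * (\<bar>pi * y\<bar> / 2)\<^sup>2"
  proof -
    have "\<bar>pi * y\<bar> \<le> pi / 2" using y2 by (simp add: abs_mult field_simps)
    from abs_sin_ge_half[OF this] show ?thesis
      by (intro mult_left_mono) (auto simp flip: abs_le_square_iff)
  qed
  also have "4 * (\<bar>pi * y\<bar> / 2)\<^sup>2 = pi\<^sup>2 * \<bar>y\<bar>\<^sup>2" by (simp add: power_divide power_mult_distrib)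
  also have "\<dots> \<ge> 9 * r\<^sup>2"
  proof (intro mult_mono)
    have "3\<^sup>2 \<le> pi\<^sup>2" using pi_gt3 by (intro power_mono) auto
    then show "9 \<le> pi\<^sup>2" by simp
    show "r\<^sup>2 \<le> \<bar>y\<bar>\<^sup>2" using yr assms by (intro power_mono) auto
  qed auto
  finally show ?thesis by simp
qed

text \<open>With \<open>P\<close> a Fejer type polynomial and \<open>z = exp(2 \<pi> i x)\<close>, the minorant is a positive multiple of
  \<open>\<kappa> |P(z)|\<^sup>2 - |(1 - z) P(z)|\<^sup>2 / 2\<close>: it is nonpositive as soon as \<open>|1 - z|\<^sup>2 \<ge> 2 \<kappa>\<close>, while its mean is
  positive since the coefficients of \<open>(1 - z) P(z)\<close> are small compared to those of \<open>P\<close>.\<close>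

lemma trig_minorant:
  fixes n :: nat
  assumes "n \<ge> 1"
  obtains c :: "nat \<Rightarrow> real" where "c 0 = 1" "\<And>j. \<bar>c j\<bar> \<le> 10"
    "\<And>x. dist_int x \<ge> 1 / real n \<Longrightarrow> (\<Sum>j<2*n. c j * cos (real j * (2 * pi * x))) \<le> 0"
proof -
  \<comment> \<open>A tent of height \<open>n\<close> with zeros at 0 and \<open>2 * n\<close>; its
    slopes \<open>q\<close> are at most 1 in absolute value. So \<open>G\<close>, the sum of the
    squares of \<open>b\<close>, has order \<open>n ^ 3\<close>, while that of \<open>q\<close> has
    order \<open>n\<close>.\<close>
  define b where "b k = real (min k (2 * n - k))" for k
  define q where "q k = b (Suc k) - b k" for k
  define cor where "cor d j = (if j = 0 then 1 else 2) * (\<Sum>k<2*n-j. d k * d (k + j))" for d :: "nat \<Rightarrow> real" and j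
  define G where "G = (\<Sum>k<2*n. (b k)\<^sup>2)"
  define E where "E = (\<Sum>k<2*n. (q k)\<^sup>2)"
  \<comment> \<open>Half of the lower bound \<open>9 * r\<^sup>2\<close> for
    \<open>|1 - z|\<^sup>2\<close> at \<open>r = 1 / n\<close>.\<close>
  define \<kappa> where "\<kappa> = 9 / (2 * (real n)\<^sup>2)"
  have \<kappa>0: "\<kappa> > 0" using assms by (simp add: \<kappa>_def)
  have E: "E \<le> 2 * real n"
  proof -
    have "(q k)\<^sup>2 \<le> 1" for k
      unfolding abs_square_le_1 q_def b_def by (auto simp: min_def)
    then have "E \<le> (\<Sum>k<2*n. 1)" unfolding E_def by (intro sum_mono)
    then show ?thesis by simp
  qed
  have G: "G \<ge> real n ^ 3 / 3"
  proof -
    have "6 * (\<Sum>k\<le>m. (real k)\<^sup>2) = real m * (real m + 1) * (2 * real m + 1)" for m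
      by (induction m) (auto simp: algebra_simps power2_eq_square)
    from this[of n] have "6 * (\<Sum>k\<le>n. (real k)\<^sup>2) \<ge> 2 * real n ^ 3"
      by (simp add: algebra_simps power2_eq_square power3_eq_cube)
    moreover have "(\<Sum>k\<le>n. (real k)\<^sup>2) = (\<Sum>k\<le>n. (b k)\<^sup>2)"
      by (intro sum.cong) (auto simp: b_def min_def)
    moreover have "\<dots> \<le> G" unfolding G_def using assms by (intro sum_mono2) auto
    ultimately show ?thesis by simp
  qed
  have \<kappa>G: "\<kappa> * G \<ge> 3 / 2 * real n"
  proof -
    have "\<kappa> * (real n ^ 3 / 3) \<le> \<kappa> * G" using G \<kappa>0 by (intro mult_left_mono) auto
    moreover have "\<kappa> * (real n ^ 3 / 3) = 3 / 2 * real n"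
      using assms by (simp add: \<kappa>_def power2_eq_square power3_eq_cube)
    ultimately show ?thesis by simp
  qed
  \<comment> \<open>The mean of the unnormalised minorant. It is positive since
    \<open>\<kappa> * G \<ge> 3 / 2 * n\<close> and \<open>E / 2 \<le> n\<close>; dividing by it
    makes the mean 1.\<close>
  define A where "A = \<kappa> * G - E / 2"
  have n0: "real n > 0" using assms by simp
  have A: "A > 0" using \<kappa>G E n0 unfolding A_def by linarith
  have cor0: "cor b 0 = G" "cor q 0 = E" by (simp_all add: cor_def G_def E_def power2_eq_square)
  have corle: "\<bar>cor d j\<bar> \<le> 2 * (\<Sum>k<2*n. (d k)\<^sup>2)" for d j
    using autocorrelation_bound[where b = d and m = "2 * n" and j = j] unfolding cor_def
    by (auto simp: abs_mult)
  define c where "c j = (\<kappa> * cor b j - cor q j / 2) / A" for j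
  show ?thesis
  proof
    show "c 0 = 1" using A by (simp add: c_def cor0 A_def)
    fix j
    have "\<bar>\<kappa> * cor b j\<bar> \<le> \<kappa> * (2 * G)"
      unfolding abs_mult using corle[of b j] \<kappa>0 by (simp add: G_def)
    moreover have "\<bar>cor q j / 2\<bar> \<le> E" using corle[of q j] by (simp add: E_def)
    ultimately have "\<bar>\<kappa> * cor b j - cor q j / 2\<bar> \<le> 2 * (\<kappa> * G) + E" by linarith
    \<comment> \<open>The extreme values \<open>\<kappa> * G = 3 / 2 * n\<close> and
      \<open>E = 2 * n\<close> give equality, whence the constant 10.\<close>
    also have "\<dots> \<le> 10 * A"
    proof -
      have "2 * w + e \<le> 10 * (w - e / 2)" if "w \<ge> 3 / 2 * m" "e \<le> 2 * m" for w e m :: real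
        using that by (simp add: field_simps)
      then show ?thesis using \<kappa>G E unfolding A_def by blast
    qed
    finally show "\<bar>c j\<bar> \<le> 10" using A by (simp add: c_def field_simps)
  next
    fix x assume "dist_int x \<ge> 1 / real n"
    then have "(norm (1 - cis (2 * pi * x)))\<^sup>2 \<ge> 9 * (1 / real n)\<^sup>2"
      by (intro norm_one_minus_cis_ge) auto
    then have z: "(norm (1 - cis (2 * pi * x)))\<^sup>2 \<ge> 2 * \<kappa>" by (simp add: \<kappa>_def power_divide)
    let ?P = "\<lambda>d. (norm (\<Sum>k<2*n. of_real (d k :: real) * cis (2 * pi * x) ^ k))\<^sup>2"
    have "A * (\<Sum>j<2*n. c j * cos (real j * (2 * pi * x)))
        = (\<Sum>j<2*n. \<kappa> * (cor b j * cos (real j * (2 * pi * x))) - cor q j * cos (real j * (2 * pi * x)) / 2)"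
      unfolding sum_distrib_left using A by (intro sum.cong refl) (simp add: c_def field_simps)
    also have "\<dots> = \<kappa> * ?P b - ?P q / 2"
      unfolding norm_cis_sum_power2 cor_def by (simp add: sum_subtractf sum_distrib_left sum_divide_distrib)
    also have "?P q = (norm (1 - cis (2 * pi * x)))\<^sup>2 * ?P b"
      unfolding q_def
      by (subst norm_difference_cis_sum) (auto simp: b_def power_mult_distrib norm_cis)
    also have "\<kappa> * ?P b - (norm (1 - cis (2 * pi * x)))\<^sup>2 * ?P b / 2
        = ?P b * (\<kappa> - (norm (1 - cis (2 * pi * x)))\<^sup>2 / 2)" by (simp add: algebra_simps)
    also have "\<dots> \<le> 0" using z by (intro mult_nonneg_nonpos) auto
    finally show "(\<Sum>j<2*n. c j * cos (real j * (2 * pi * x))) \<le> 0"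
      using A by (simp add: mult_le_0_iff)
  qed
qed

subsection \<open>The second moment\<close>

lemma integrable_cos_std_normal [simp]: "integrable std_normal_distribution (\<lambda>x. cos (t * x))"
proof -
  interpret real_distribution std_normal_distribution by (rule real_dist_normal_dist)
  show ?thesis by (rule integrable_const_bound[of _ 1]) auto
qed

text \<open>This is the real part of the characteristic function. It turns second moments into the
  Gaussian sums bounded above.\<close>

lemma integral_cos_std_normal: "(\<integral>x. cos (t * x) \<partial>std_normal_distribution) = exp (- t\<^sup>2 / 2)"
proof -
  interpret real_distribution std_normal_distribution by (rule real_dist_normal_dist)
  have "integrable std_normal_distribution (\<lambda>x. iexp (t * x))"
    by (rule integrable_iexp) auto
  then have "(\<integral>x. Re (iexp (t * x)) \<partial>std_normal_distribution) = Re (char std_normal_distribution t)"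
    unfolding char_def by simp
  then show ?thesis by (simp add: char_std_normal_distribution Re_exp)
qed

text \<open>Each product of cosines splits into the difference and the sum of the frequencies. As
  these have the same sign, the sum frequency is at least as large in absolute value, so its
  Gaussian is dominated by that of the difference.\<close>

lemma integral_cos_sum_squared_le:
  fixes c \<nu> :: "'a \<Rightarrow> real" and K :: real
  assumes "finite A" and c: "\<And>p. p \<in> A \<Longrightarrow> \<bar>c p\<bar> \<le> K"
    and \<nu>: "\<And>p q. p \<in> A \<Longrightarrow> q \<in> A \<Longrightarrow> \<nu> p * \<nu> q \<ge> 0"
  shows "integrable std_normal_distribution (\<lambda>x. (\<Sum>p\<in>A. c p * cos (\<nu> p * x))\<^sup>2)"
    and "(\<integral>x. (\<Sum>p\<in>A. c p * cos (\<nu> p * x))\<^sup>2 \<partial>std_normal_distribution)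
           \<le> K\<^sup>2 * (\<Sum>p\<in>A. \<Sum>q\<in>A. exp (- (\<nu> p - \<nu> q)\<^sup>2 / 2))"
proof -
  have eq: "(\<Sum>p\<in>A. c p * cos (\<nu> p * x))\<^sup>2
      = (\<Sum>p\<in>A. \<Sum>q\<in>A. c p * c q / 2 * (cos ((\<nu> p - \<nu> q) * x) + cos ((\<nu> p + \<nu> q) * x)))" for x
    unfolding power2_eq_square sum_product
    by (intro sum.cong refl) (simp add: cos_add cos_diff algebra_simps)
  show "integrable std_normal_distribution (\<lambda>x. (\<Sum>p\<in>A. c p * cos (\<nu> p * x))\<^sup>2)"
    unfolding eq by (intro Bochner_Integration.integrable_sum integrable_mult_right
      Bochner_Integration.integrable_add integrable_cos_std_normal)
  have "(\<integral>x. (\<Sum>p\<in>A. c p * cos (\<nu> p * x))\<^sup>2 \<partial>std_normal_distribution)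
      = (\<Sum>p\<in>A. \<Sum>q\<in>A. c p * c q / 2 * (exp (- (\<nu> p - \<nu> q)\<^sup>2 / 2) + exp (- (\<nu> p + \<nu> q)\<^sup>2 / 2)))"
    unfolding eq by (simp add: integral_cos_std_normal)
  also have "\<dots> \<le> (\<Sum>p\<in>A. \<Sum>q\<in>A. K\<^sup>2 * exp (- (\<nu> p - \<nu> q)\<^sup>2 / 2))"
  proof (intro sum_mono)
    fix p q assume pq: "p \<in> A" "q \<in> A"
    have "K \<ge> 0" using c[OF pq(1)] by linarith
    have "\<bar>c p * c q\<bar> \<le> K * K" unfolding abs_mult
      using pq c \<open>K \<ge> 0\<close> by (intro mult_mono) auto
    moreover have "(\<nu> p - \<nu> q)\<^sup>2 \<le> (\<nu> p + \<nu> q)\<^sup>2"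
      using \<nu>[OF pq] by (simp add: power2_sum power2_diff)
    ultimately have "(c p * c q / 2) * (exp (- (\<nu> p - \<nu> q)\<^sup>2 / 2) + exp (- (\<nu> p + \<nu> q)\<^sup>2 / 2))
        \<le> (K * K / 2) * (exp (- (\<nu> p - \<nu> q)\<^sup>2 / 2) + exp (- (\<nu> p - \<nu> q)\<^sup>2 / 2))"
      by (intro mult_mono) auto
    then show "(c p * c q / 2) * (exp (- (\<nu> p - \<nu> q)\<^sup>2 / 2) + exp (- (\<nu> p + \<nu> q)\<^sup>2 / 2))
        \<le> K\<^sup>2 * exp (- (\<nu> p - \<nu> q)\<^sup>2 / 2)" by (simp add: power2_eq_square)
  qed
  finally show "(\<integral>x. (\<Sum>p\<in>A. c p * cos (\<nu> p * x))\<^sup>2 \<partial>std_normal_distribution)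
           \<le> K\<^sup>2 * (\<Sum>p\<in>A. \<Sum>q\<in>A. exp (- (\<nu> p - \<nu> q)\<^sup>2 / 2))"
    by (simp add: sum_distrib_left)
qed

text \<open>The Chebyshev step, with \<open>K\<close> independent of \<open>M\<close>,
  \<open>n\<close> and \<open>D\<close>. The constant 800 is \<open>10\<^sup>2 * 4 * 2\<close>: the
  coefficient bound squared, the frequency bound, and \<open>J \<le> 2 * n\<close>.\<close>

lemma exceptional_set_measure_bound:
  fixes a \<beta> :: real
  assumes "a \<noteq> 0"
  obtains K where "\<And>(M::nat) (n::nat) (D::real). \<lbrakk>M \<ge> 1; real M + \<beta> \<ge> 0; n \<ge> 1; D \<ge> 1;
      \<And>u::nat. 1 \<le> u \<Longrightarrow> u \<le> 2 * n * M * M \<Longrightarrow> real (card {d. d dvd u}) \<le> D\<rbrakk> \<Longrightarrow>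
      \<exists>B \<in> sets std_normal_distribution.
        {\<alpha>. \<forall>d\<in>{1..M}. \<forall>s\<in>{M<..2*M}. dist_int (\<alpha> * (4 * a * real d * (real s + \<beta>))) \<ge> 1 / real n} \<subseteq> B \<and>
        measure std_normal_distribution B \<le> K * D ^ 3 * real n / (real M)\<^sup>2"
proof -
  interpret real_distribution std_normal_distribution by (rule real_dist_normal_dist)
  \<comment> \<open>The frequencies carry \<open>8 * pi * a\<close>, that is, \<open>2 * pi\<close>
    from the minorant times \<open>4 * a\<close> from the differences; the half is that of the
    normal characteristic function.\<close>
  define \<kappa> where "\<kappa> = (8 * pi * a)\<^sup>2 / 2"
  have "\<kappa> > 0" using assms by (simp add: \<kappa>_def)
  then obtain C where C: "C \<ge> 1" "\<And>(A :: int set) \<theta>. finite A \<Longrightarrow> (\<Sum>n\<in>A. exp (- \<kappa> * (of_int n + \<theta>)\<^sup>2)) \<le> C"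
    using sum_exp_neg_square_shift_bound by blast
  show ?thesis
  proof (rule that[of "800 * C"])
    fix M n :: nat and D :: real
    assume M: "M \<ge> 1" and \<beta>: "real M + \<beta> \<ge> 0" and n: "n \<ge> 1" and D1: "D \<ge> 1"
      and D: "\<And>u::nat. 1 \<le> u \<Longrightarrow> u \<le> 2 * n * M * M \<Longrightarrow> real (card {d. d dvd u}) \<le> D"
    obtain c :: "nat \<Rightarrow> real" where c: "c 0 = 1" "\<And>j. \<bar>c j\<bar> \<le> 10"
      "\<And>x. dist_int x \<ge> 1 / real n \<Longrightarrow> (\<Sum>j<2*n. c j * cos (real j * (2 * pi * x))) \<le> 0"
      using trig_minorant[OF n] by blast
    define J where "J = 2 * n - 1"
    have J: "J \<ge> 1" "{..<2*n} = insert 0 {1..J}" using n by (auto simp: J_def)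
    let ?S = "{M<..2*M}" let ?A = "?S \<times> {1..J} \<times> {1..M}"
    define \<nu> where "\<nu> = (\<lambda>(s, j, d). 8 * pi * a * (real (j * d) * (real s + \<beta>)))"
    \<comment> \<open>The summed minorants without their constant terms
      \<open>c 0 = 1\<close>.\<close>
    define F where "F \<alpha> = (\<Sum>p\<in>?A. c (fst (snd p)) * cos (\<nu> p * \<alpha>))" for \<alpha>
    have pos: "\<nu> p * \<nu> q \<ge> 0" if "p \<in> ?A" "q \<in> ?A" for p q
    proof -
      have *: "\<exists>t\<ge>0. \<nu> p = 8 * pi * a * t" if "p \<in> ?A" for p
      proof -
        from that obtain s j d where "p = (s, j, d)" "s \<in> ?S" by blast
        then show ?thesis using \<beta>
          by (intro exI[of _ "real (j * d) * (real s + \<beta>)"]) (auto simp: \<nu>_def)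
      qed
      from *[OF that(1)] *[OF that(2)] obtain t u where
        "t \<ge> 0" "u \<ge> 0" "\<nu> p = 8 * pi * a * t" "\<nu> q = 8 * pi * a * u" by blast
      moreover then have "\<nu> p * \<nu> q = (8 * pi * a)\<^sup>2 * (t * u)" by (simp add: power2_eq_square mult_ac)
      ultimately show ?thesis by (simp only: mult_nonneg_nonneg zero_le_power2)
    qed
    have int: "integrable std_normal_distribution (\<lambda>\<alpha>. (F \<alpha>)\<^sup>2)"
      unfolding F_def using c(2) pos by (intro integral_cos_sum_squared_le(1)) auto
    have "(\<integral>\<alpha>. (F \<alpha>)\<^sup>2 \<partial>std_normal_distribution) \<le> 10\<^sup>2 * (\<Sum>p\<in>?A. \<Sum>q\<in>?A. exp (- (\<nu> p - \<nu> q)\<^sup>2 / 2))"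
      unfolding F_def using c(2) pos by (intro integral_cos_sum_squared_le(2)) auto
    also have "(\<Sum>p\<in>?A. \<Sum>q\<in>?A. exp (- (\<nu> p - \<nu> q)\<^sup>2 / 2)) =
       (\<Sum>(s, j, d)\<in>?A. \<Sum>(s', l, d')\<in>?A.
            exp (- \<kappa> * (real (j * d) * (real s + \<beta>) - real (l * d') * (real s' + \<beta>))\<^sup>2))"
      by (intro sum.cong refl)
        (auto simp: \<nu>_def \<kappa>_def case_prod_unfold power_mult_distrib simp flip: right_diff_distrib
          intro!: sum.cong)
    also have "\<dots> \<le> 4 * C * D ^ 3 * real J * (real M)\<^sup>2"
    proof (rule sum_exp_frequency_bound)
      fix u :: nat assume "1 \<le> u" "u \<le> J * M * M"
      moreover have "J * M * M \<le> 2 * n * M * M" by (intro mult_le_mono) (auto simp: J_def)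
      ultimately show "real (card {d. d dvd u}) \<le> D" by (intro D) linarith+
    qed (use \<open>\<kappa> > 0\<close> \<beta> J(1) M C D1 in auto)
    also have "4 * C * D ^ 3 * real J * (real M)\<^sup>2 \<le> 4 * C * D ^ 3 * (2 * real n) * (real M)\<^sup>2"
      using C(1) D1 by (intro mult_right_mono mult_left_mono) (auto simp: J_def)
    finally have EF: "(\<integral>\<alpha>. (F \<alpha>)\<^sup>2 \<partial>std_normal_distribution) \<le> 800 * C * D ^ 3 * real n * (real M)\<^sup>2"
      by simp
    define B where "B = {\<alpha> \<in> space std_normal_distribution. (F \<alpha>)\<^sup>2 \<ge> (real M) ^ 4}"
    have meas: "(\<lambda>\<alpha>. (F \<alpha>)\<^sup>2) \<in> borel_measurable std_normal_distribution"
      using int by (rule borel_measurable_integrable)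
    have "B \<in> sets std_normal_distribution" unfolding B_def using meas by measurable
    moreover have "{\<alpha>. \<forall>d\<in>{1..M}. \<forall>s\<in>?S. dist_int (\<alpha> * (4 * a * real d * (real s + \<beta>))) \<ge> 1 / real n} \<subseteq> B"
    proof clarify
      fix \<alpha> assume bad: "\<forall>d\<in>{1..M}. \<forall>s\<in>?S. dist_int (\<alpha> * (4 * a * real d * (real s + \<beta>))) \<ge> 1 / real n"
      have "F \<alpha> = (\<Sum>s\<in>?S. \<Sum>j\<in>{1..J}. \<Sum>d\<in>{1..M}. c j * cos (\<nu> (s, j, d) * \<alpha>))"
        unfolding F_def by (simp add: sum.cartesian_product case_prod_unfold)
      also have "\<dots> = (\<Sum>s\<in>?S. \<Sum>d\<in>{1..M}. \<Sum>j\<in>{1..J}. c j * cos (\<nu> (s, j, d) * \<alpha>))"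
        by (intro sum.cong refl sum.swap)
      \<comment> \<open>On the bad set each minorant is nonpositive, so its nonconstant part is at
        most -1, for each of the \<open>M\<^sup>2\<close> pairs.\<close>
      also have "\<dots> \<le> (\<Sum>s\<in>?S. \<Sum>d\<in>{1..M}. - 1)"
      proof (intro sum_mono)
        fix s d assume sd: "s \<in> ?S" "d \<in> {1..M}"
        have "(\<Sum>j<2*n. c j * cos (real j * (2 * pi * (\<alpha> * (4 * a * real d * (real s + \<beta>)))))) \<le> 0"
          using bad sd by (intro c(3)) auto
        then show "(\<Sum>j\<in>{1..J}. c j * cos (\<nu> (s, j, d) * \<alpha>)) \<le> - 1"
          unfolding J(2) by (simp add: c(1) \<nu>_def mult_ac)
      qed
      also have "\<dots> = - (real M)\<^sup>2" by (simp add: power2_eq_square)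
      finally have "((real M)\<^sup>2)\<^sup>2 \<le> (F \<alpha>)\<^sup>2"
        by (intro iffD1[OF abs_le_square_iff]) auto
      then show "\<alpha> \<in> B" unfolding B_def by (simp flip: power_mult)
    qed
    moreover have "measure std_normal_distribution B \<le> 800 * C * D ^ 3 * real n / (real M)\<^sup>2"
    proof -
      have "measure std_normal_distribution B \<le> (\<integral>\<alpha>. (F \<alpha>)\<^sup>2 \<partial>std_normal_distribution) / real M ^ 4"
        unfolding B_def using M
        by (intro integral_Markov_inequality_measure[where A = "{}"] int) auto
      also have "\<dots> \<le> (800 * C * D ^ 3 * real n * (real M)\<^sup>2) / real M ^ 4"
        by (intro divide_right_mono EF) auto
      also have "\<dots> = 800 * C * D ^ 3 * real n / (real M)\<^sup>2"
        using M by (simp add: power2_eq_square eval_nat_numeral)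
      finally show ?thesis .
    qed
    ultimately show "\<exists>B \<in> sets std_normal_distribution.
        {\<alpha>. \<forall>d\<in>{1..M}. \<forall>s\<in>?S. dist_int (\<alpha> * (4 * a * real d * (real s + \<beta>))) \<ge> 1 / real n} \<subseteq> B \<and>
        measure std_normal_distribution B \<le> 800 * C * D ^ 3 * real n / (real M)\<^sup>2"
      by blast
  qed
qed

subsection \<open>Almost all dilations\<close>

text \<open>With \<open>M = 2 ^ k\<close> and \<open>n\<close> about
  \<open>M powr (2 - \<epsilon>)\<close>, the bad set has measure of order
  \<open>D ^ 3 * M powr (- \<epsilon>)\<close>. The divisor bound makes \<open>D ^ 3\<close> of
  order \<open>M powr (\<epsilon> / 2)\<close>, which leaves a geometric series.\<close>

lemma AE_eventually_small_product:
  fixes a \<beta> \<epsilon> :: real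
  assumes a: "a \<noteq> 0" and \<epsilon>: "0 < \<epsilon>" "\<epsilon> \<le> 1"
  shows "AE \<alpha> in lborel. \<forall>\<^sub>F k in sequentially. \<exists>d\<in>{1..2^k}. \<exists>s\<in>{2^k<..2*2^k}.
           dist_int (\<alpha> * (4 * a * real d * (real s + \<beta>))) < 2 * (2 ^ k) powr (\<epsilon> - 2)"
proof -
  interpret real_distribution std_normal_distribution by (rule real_dist_normal_dist)
  let ?P = std_normal_distribution
  define n where "n k = nat \<lfloor>(2 ^ k :: real) powr (2 - \<epsilon>)\<rfloor>" for k :: nat
  define bad where "bad k = {\<alpha>. \<forall>d\<in>{1..2^k}. \<forall>s\<in>{2^k<..2*2^k}.
      dist_int (\<alpha> * (4 * a * real d * (real s + \<beta>))) \<ge> 1 / real (n k)}" for k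
  have pow1: "(2 ^ k :: real) powr (2 - \<epsilon>) \<ge> 1" for k using \<epsilon> by (intro ge_one_powr_ge_zero) auto
  have n1: "n k \<ge> 1" for k using pow1[of k] unfolding n_def by linarith
  have nle: "real (n k) \<le> (2 ^ k) powr (2 - \<epsilon>)" for k using pow1[of k] unfolding n_def by linarith
  have nge: "real (n k) \<ge> (2 ^ k) powr (2 - \<epsilon>) / 2" for k 
  proof -
    have "x / 2 \<le> real (nat \<lfloor>x\<rfloor>)" if "x \<ge> 1" for x :: real
    proof -
      have "real (nat \<lfloor>x\<rfloor>) = of_int \<lfloor>x\<rfloor>" "\<lfloor>x\<rfloor> \<ge> 1" using that by auto
      moreover then have "1 \<le> (of_int \<lfloor>x\<rfloor> :: real)" by linarith
      ultimately show ?thesis using floor_correct[of x] by linarith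
    qed
    then show ?thesis using pow1[of k] unfolding n_def by blast
  qed
  \<comment> \<open>The divisor bound is applied to integers up to
    \<open>2 * n * M\<^sup>2 \<le> 2 * M ^ 4\<close>; its cube has exponent
    \<open>12 * \<eta> = \<epsilon> / 2\<close>.\<close>
  define \<eta> where "\<eta> = \<epsilon> / 24"
  have "\<eta> > 0" using \<epsilon> by (simp add: \<eta>_def)
  then obtain Cd where Cd: "Cd \<ge> 1" "\<And>u::nat. u > 0 \<Longrightarrow> real (card {d. d dvd u}) \<le> Cd * real u powr \<eta>"
    using card_divisors_bound by blast
  obtain K where K: "\<And>(M::nat) (n::nat) (D::real). \<lbrakk>M \<ge> 1; real M + \<beta> \<ge> 0; n \<ge> 1; D \<ge> 1;
      \<And>u::nat. 1 \<le> u \<Longrightarrow> u \<le> 2 * n * M * M \<Longrightarrow> real (card {d. d dvd u}) \<le> D\<rbrakk> \<Longrightarrow>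
      \<exists>B \<in> sets ?P.
        {\<alpha>. \<forall>d\<in>{1..M}. \<forall>s\<in>{M<..2*M}. dist_int (\<alpha> * (4 * a * real d * (real s + \<beta>))) \<ge> 1 / real n} \<subseteq> B \<and>
        measure ?P B \<le> K * D ^ 3 * real n / (real M)\<^sup>2"
    using exceptional_set_measure_bound[OF a, of \<beta>] by blast
  \<comment> \<open>From here on \<open>2 ^ k \<ge> k \<ge> - \<beta>\<close>, as the measure bound
    requires.\<close>
  define k0 where "k0 = nat \<lceil>- \<beta>\<rceil>"
  define D where "D k = Cd * (2 * (2 ^ k) ^ 4) powr \<eta>" for k :: nat
  define q where "q = 2 powr (- \<epsilon> / 2)"
  define K' where "K' = \<bar>K\<bar> * (Cd ^ 3 * 2 powr (\<epsilon> / 8))"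
  have bound: "K * D k ^ 3 * real (n k) / (real (2 ^ k))\<^sup>2 \<le> K' * q ^ k" for k
  proof -
    let ?M = "2 ^ k :: real"
    have "D k ^ 3 = Cd ^ 3 * ((2 * ?M ^ 4) powr \<eta>) powr 3"
      by (simp add: D_def power_mult_distrib powr_numeral)
    also have "((2 * ?M ^ 4) powr \<eta>) powr 3 = 2 powr (\<epsilon> / 8) * ?M powr (\<epsilon> / 2)"
      by (simp add: powr_powr powr_mult \<eta>_def flip: powr_numeral)
    finally have D3: "D k ^ 3 = Cd ^ 3 * 2 powr (\<epsilon> / 8) * ?M powr (\<epsilon> / 2)" by simp
    have "K * D k ^ 3 * real (n k) / (real (2 ^ k))\<^sup>2 = K * (D k ^ 3 * (real (n k) / ?M\<^sup>2))" by simp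
    also have "\<dots> \<le> \<bar>K\<bar> * (D k ^ 3 * (?M powr (2 - \<epsilon>) / ?M\<^sup>2))"
      using Cd(1) nle[of k] by (intro mult_mono mult_nonneg_nonneg divide_right_mono) (auto simp: D_def)
    also have "?M powr (2 - \<epsilon>) / ?M\<^sup>2 = ?M powr (- \<epsilon>)"
      by (simp add: powr_diff powr_minus field_simps flip: powr_numeral)
    also have "\<bar>K\<bar> * (D k ^ 3 * ?M powr (- \<epsilon>)) = K' * (?M powr (\<epsilon> / 2) * ?M powr (- \<epsilon>))"
      by (simp add: D3 K'_def)
    also have "?M powr (\<epsilon> / 2) * ?M powr (- \<epsilon>) = ?M powr (- \<epsilon> / 2)"
      by (simp flip: powr_add)
    also have "\<dots> = q ^ k" by (simp add: q_def powr_powr mult.commute flip: powr_realpow)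
    finally show ?thesis .
  qed
  have ex: "\<exists>B\<in>sets ?P. bad k \<subseteq> B \<and> measure ?P B \<le> K' * q ^ k" if "k \<ge> k0" for k
  proof -
    have "\<exists>B\<in>sets ?P. bad k \<subseteq> B \<and> measure ?P B \<le> K * D k ^ 3 * real (n k) / (real (2 ^ k))\<^sup>2"
      unfolding bad_def
    proof (rule K)
      have "- \<beta> \<le> real k" using that unfolding k0_def by linarith
      also have "real k \<le> real (2 ^ k)" by (intro of_nat_mono less_imp_le less_exp)
      finally show "real (2 ^ k) + \<beta> \<ge> 0" by simp
      have "(1::real) \<le> (2 ^ k) ^ 4" by (intro one_le_power) auto
      then have "(1::real) \<le> 2 * (2 ^ k) ^ 4" by linarith
      then have "1 * 1 \<le> Cd * (2 * (2 ^ k) ^ 4) powr \<eta>"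
        using Cd(1) \<open>\<eta> > 0\<close> by (intro mult_mono ge_one_powr_ge_zero) auto
      then show "D k \<ge> 1" by (simp add: D_def)
      fix u :: nat assume u: "1 \<le> u" "u \<le> 2 * n k * 2 ^ k * 2 ^ k"
      have "real (n k) \<le> (2 ^ k) powr 2"
        by (rule order_trans[OF nle], rule powr_mono) (use \<epsilon> in auto)
      then have n2: "real (n k) \<le> (2 ^ k)\<^sup>2" by (simp add: powr_numeral)
      have "real u \<le> real (2 * n k * 2 ^ k * 2 ^ k)" using u(2) by (rule of_nat_mono)
      also have "\<dots> = 2 * (real (n k) * (2 ^ k)\<^sup>2)" by (simp add: power2_eq_square)
      also have "\<dots> \<le> 2 * ((2 ^ k)\<^sup>2 * (2 ^ k)\<^sup>2)" using n2 by (intro mult_left_mono mult_right_mono) auto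
      also have "\<dots> = 2 * (2 ^ k) ^ 4" by (simp add: power2_eq_square eval_nat_numeral)
      finally have "real u powr \<eta> \<le> (2 * (2 ^ k) ^ 4) powr \<eta>"
        using \<open>\<eta> > 0\<close> by (intro powr_mono2) auto
      then have "Cd * real u powr \<eta> \<le> D k" unfolding D_def using Cd(1) by (intro mult_left_mono) auto
      then show "real (card {d. d dvd u}) \<le> D k" using Cd(2)[of u] u(1) by linarith
    qed (use n1[of k] in auto)
    then show ?thesis using order_trans[OF _ bound[of k]] by blast
  qed
  \<comment> \<open>The finitely many \<open>k < k0\<close> get the empty set.\<close>
  have "\<exists>B. \<forall>k. B k \<in> sets ?P \<and> measure ?P (B k) \<le> K' * q ^ k \<and> (k \<ge> k0 \<longrightarrow> bad k \<subseteq> B k)"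
  proof (intro choice allI)
    fix k
    have "0 \<le> K' * q ^ k" using Cd(1) by (simp add: K'_def q_def)
    then show "\<exists>B. B \<in> sets ?P \<and> measure ?P B \<le> K' * q ^ k \<and> (k \<ge> k0 \<longrightarrow> bad k \<subseteq> B)"
    proof (cases "k \<ge> k0")
      case True
      then show ?thesis using ex[of k] by blast
    next
      case False
      then show ?thesis using \<open>0 \<le> K' * q ^ k\<close> by (intro exI[of _ "{}"]) simp
    qed
  qed
  then obtain B where B: "\<And>k. B k \<in> sets ?P" "\<And>k. measure ?P (B k) \<le> K' * q ^ k"
    "\<And>k. k \<ge> k0 \<Longrightarrow> bad k \<subseteq> B k" by metis
  have "q < 1" using \<epsilon> unfolding q_def by (simp add: powr_less_one)
  then have "summable (\<lambda>k. K' * q ^ k)"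
    by (intro summable_mult summable_geometric) (simp add: q_def)
  then have "summable (\<lambda>k. measure ?P (B k))"
    by (rule summable_comparison_test'[where N = 0]) (use B(2) in auto)
  then have "AE \<alpha> in ?P. \<forall>\<^sub>F k in sequentially. \<alpha> \<in> space ?P - B k"
    using B(1) by (intro borel_cantelli_AE1) (auto simp: emeasure_eq_measure)
  \<comment> \<open>The normal density is positive everywhere, so its null sets are Lebesgue
    null.\<close>
  then have "AE \<alpha> in lborel. \<forall>\<^sub>F k in sequentially. \<alpha> \<in> space ?P - B k"
    by (subst (asm) AE_density) (auto simp: normal_density_pos)
  then show ?thesis
  proof eventually_elim
    case (elim \<alpha>)
    show ?case using elim eventually_ge_at_top[of k0]
    proof eventually_elim
      case (elim k)
      then have "\<alpha> \<notin> bad k" using B(3) by blast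
      then obtain d s where ds: "d \<in> {1..2^k}" "s \<in> {2^k<..2*2^k}"
        "dist_int (\<alpha> * (4 * a * real d * (real s + \<beta>))) < 1 / real (n k)"
        unfolding bad_def by (auto simp: not_le)
      have "1 / real (n k) \<le> 1 / ((2 ^ k) powr (2 - \<epsilon>) / 2)"
        using nge[of k] pow1[of k] by (intro divide_left_mono mult_pos_pos) auto
      also have "\<dots> = 2 * (2 ^ k) powr (\<epsilon> - 2)"
        using powr_minus_divide[of "2 ^ k :: real" "2 - \<epsilon>"] by simp
      finally show ?case using ds by force
    qed
  qed
qed

section \<open>From small products to the minimal gap and its exponent\<close>

lemma finite_delta_min_set:
  "finite {dist_int (\<alpha> * x m - \<alpha> * x n) | m n.
      1 \<le> m \<and> m \<le> N \<and> 1 \<le> n \<and> n \<le> (N::nat) \<and> m \<noteq> n}" (is "finite ?A")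
proof (rule finite_subset)
  show "?A \<subseteq> (\<lambda>(m, n). dist_int (\<alpha> * x m - \<alpha> * x n)) ` ({..N} \<times> {..N})" by auto
qed simp

lemma delta_min_le:
  assumes "1 \<le> m" "m \<le> N" "1 \<le> n" "n \<le> N" "m \<noteq> n"
  shows "delta_min \<alpha> x N \<le> dist_int (\<alpha> * x m - \<alpha> * x n)"
  unfolding delta_min_def using assms by (intro Min_le finite_delta_min_set) blast

lemma delta_min_nonneg:
  assumes "N \<ge> 2"
  shows "delta_min \<alpha> x N \<ge> 0"
proof -
  let ?A = "{dist_int (\<alpha> * x m - \<alpha> * x n) | m n. 1 \<le> m \<and> m \<le> N \<and> 1 \<le> n \<and> n \<le> N \<and> m \<noteq> n}"
  have "dist_int (\<alpha> * x 1 - \<alpha> * x 2) \<in> ?A"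
    using assms by (intro CollectI exI[of _ 1] exI[of _ 2]) auto
  then have "delta_min \<alpha> x N \<in> ?A"
    unfolding delta_min_def by (intro Min_in finite_delta_min_set) blast
  moreover have "dist_int y \<ge> 0" for y
    unfolding dist_int_def by (intro cINF_greatest) auto
  ultimately show ?thesis by auto
qed

text \<open>The indices \<open>s + d\<close> and \<open>s - d\<close> lie between 1 and
  \<open>3 * 2 ^ k\<close>, so the scale \<open>2 ^ k\<close> serves every \<open>N\<close> with
  \<open>3 * 2 ^ k \<le> N < 6 * 2 ^ k\<close>. Replacing \<open>2 ^ k\<close> by
  \<open>N / 6\<close> costs at most \<open>6\<^sup>2\<close>, hence 72.\<close>

lemma AE_delta_min_quadratic:
  fixes a b c \<epsilon> :: real
  assumes a: "a \<noteq> 0" and \<epsilon>: "0 < \<epsilon>" "\<epsilon> \<le> 1"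
  shows "AE \<alpha> in lborel. \<forall>\<^sub>F N in sequentially.
           delta_min \<alpha> (\<lambda>n. a * (real n)\<^sup>2 + b * real n + c) N \<le> 72 * real N powr (\<epsilon> - 2)"
proof -
  define \<beta> where "\<beta> = b / (2 * a)"
  let ?x = "\<lambda>n. a * (real n)\<^sup>2 + b * real n + c"
  show ?thesis using AE_eventually_small_product[OF assms, of \<beta>]
  proof eventually_elim
    case (elim \<alpha>)
    then obtain K where K: "\<And>k. k \<ge> K \<Longrightarrow> \<exists>d\<in>{1..2^k}. \<exists>s\<in>{2^k<..2*2^k}.
           dist_int (\<alpha> * (4 * a * real d * (real s + \<beta>))) < 2 * (2 ^ k) powr (\<epsilon> - 2)"
      unfolding eventually_sequentially by blast
    show ?case using eventually_ge_at_top[of "6 * 2 ^ K"]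
    proof eventually_elim
      case (elim N)
      have "(1::nat) \<le> 2 ^ K" by simp
      then have "N div 3 \<ge> 1" using elim by linarith
      then obtain k where k: "2 ^ k \<le> N div 3" "N div 3 < 2 ^ (k + 1)"
        using ex_power_ivl1[of 2 "N div 3"] by auto
      have N: "3 * 2 ^ k \<le> N" "N < 6 * 2 ^ k" using k by auto
      have "(2::nat) ^ K < 2 ^ k" using elim N(2) by linarith
      then have "K \<le> k" by (simp add: power_strict_increasing_iff)
      then obtain d s where ds: "d \<in> {1..2^k}" "s \<in> {2^k<..2*2^k}"
        "dist_int (\<alpha> * (4 * a * real d * (real s + \<beta>))) < 2 * (2 ^ k) powr (\<epsilon> - 2)"
        using K by blast
      have "\<alpha> * ?x (s + d) - \<alpha> * ?x (s - d) = \<alpha> * (4 * a * real d * (real s + \<beta>))"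
        using ds(1,2) a by (simp add: \<beta>_def of_nat_diff field_simps power2_eq_square)
      moreover have "delta_min \<alpha> ?x N \<le> dist_int (\<alpha> * ?x (s + d) - \<alpha> * ?x (s - d))"
        using ds(1,2) N(1) by (intro delta_min_le) auto
      ultimately have "delta_min \<alpha> ?x N \<le> 2 * (2 ^ k) powr (\<epsilon> - 2)" using ds(3) by simp
      also have "\<dots> \<le> 2 * (real N / 6) powr (\<epsilon> - 2)"
      proof (intro mult_left_mono powr_mono2')
        have "real N < real (6 * 2 ^ k)" using N(2) by (rule of_nat_less_iff[THEN iffD2])
        then show "real N / 6 \<le> 2 ^ k" by simp
      qed (use \<open>N div 3 \<ge> 1\<close> \<epsilon> in auto)
      also have "\<dots> = 2 * 6 powr (2 - \<epsilon>) * real N powr (\<epsilon> - 2)"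
        by (simp add: powr_divide powr_diff)
      also have "\<dots> \<le> 2 * 6 powr 2 * real N powr (\<epsilon> - 2)"
        using \<epsilon> by (intro mult_right_mono mult_left_mono powr_mono) auto
      finally show ?case by simp
    qed
  qed
qed

text \<open>A single \<open>f\<close> for all \<open>p\<close> is read off from
  \<open>\<delta>\<close> itself: it is the excess over -2 of the exponent of
  \<open>\<delta>\<close> to base \<open>N\<close>, and the bound for each \<open>p\<close> pushes
  it below \<open>1 / Suc p\<close> plus a vanishing term.\<close>

lemma exists_vanishing_exponent:
  fixes \<delta> :: "nat \<Rightarrow> real" and C :: real
  assumes \<delta>0: "\<forall>\<^sub>F N in sequentially. \<delta> N \<ge> 0"
    and \<delta>: "\<And>p::nat. \<forall>\<^sub>F N in sequentially. \<delta> N \<le> C * real N powr (1 / Suc p - 2)"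
  shows "\<exists>f :: nat \<Rightarrow> real. f \<longlonglongrightarrow> 0 \<and> (\<forall>\<^sub>F N in sequentially. \<delta> N < real N powr (- (2 - f N)))"
proof -
  \<comment> \<open>The extra \<open>N powr - 2\<close> keeps the logarithm meaningful when
    \<open>\<delta> N = 0\<close> and makes the final inequality strict.\<close>
  define g where "g N = \<delta> N + real N powr - 2" for N
  define f where "f N = max 0 (2 + log (real N) (g N))" for N
  have gpos: "\<forall>\<^sub>F N in sequentially. g N > 0"
    using \<delta>0 eventually_gt_at_top[of 0] by eventually_elim (auto simp: g_def intro: add_nonneg_pos)
  have "f \<longlonglongrightarrow> 0"
  proof (rule order_tendstoI)
    fix e :: real assume "e < 0"
    then show "\<forall>\<^sub>F N in sequentially. e < f N" by (simp add: f_def less_max_iff_disj)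
  next
    fix e :: real assume "0 < e"
    then obtain p where p: "inverse (real (Suc p)) < e / 2" using reals_Archimedean[of "e / 2"] by auto
    \<comment> \<open>The summand 1 absorbs the extra \<open>N powr - 2\<close> in
      \<open>g\<close>.\<close>
    define C' where "C' = \<bar>C\<bar> + 1"
    have C': "C' > 0" by (simp add: C'_def)
    have "(\<lambda>N. ln C' / ln (real N)) \<longlonglongrightarrow> 0"
      by (intro tendsto_divide_0[OF tendsto_const] filterlim_at_top_imp_at_infinity
        filterlim_compose[OF ln_at_top filterlim_real_sequentially])
    then have "\<forall>\<^sub>F N in sequentially. ln C' / ln (real N) < e / 2"
      using \<open>0 < e\<close> by (intro order_tendstoD) auto
    then show "\<forall>\<^sub>F N in sequentially. f N < e"
      using \<delta>[of p] gpos eventually_gt_at_top[of 1]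
    proof eventually_elim
      case (elim N)
      have "real N powr - 2 \<le> real N powr (1 / Suc p - 2)"
        using elim by (intro powr_mono) auto
      moreover have "C * real N powr (1 / Suc p - 2) \<le> \<bar>C\<bar> * real N powr (1 / Suc p - 2)"
        by (intro mult_right_mono) auto
      ultimately have "g N \<le> C' * real N powr (1 / Suc p - 2)"
        using elim unfolding g_def C'_def distrib_right by linarith
      then have "log (real N) (g N) \<le> log (real N) (C' * real N powr (1 / Suc p - 2))"
        using elim by (intro log_mono) auto
      also have "\<dots> = log (real N) C' + (1 / Suc p - 2)"
        using elim C' by (simp add: log_mult_pos log_powr_cancel)
      finally have "log (real N) (g N) \<le> log (real N) C' + (1 / Suc p - 2)" .
      moreover have "log (real N) C' < e / 2" using elim by (simp add: log_def)
      ultimately have "2 + log (real N) (g N) < e" using p unfolding inverse_eq_divide by linarith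
      then show ?case using \<open>0 < e\<close> by (simp add: f_def)
    qed
  qed
  moreover have "\<forall>\<^sub>F N in sequentially. \<delta> N < real N powr (- (2 - f N))"
    using gpos eventually_gt_at_top[of 1]
  proof eventually_elim
    case (elim N)
    have "\<delta> N < g N" using elim by (simp add: g_def)
    also have "g N = real N powr (log (real N) (g N))" using elim by simp
    also have "\<dots> \<le> real N powr (- (2 - f N))"
      using elim by (intro powr_mono) (auto simp: f_def)
    finally show ?case .
  qed
  ultimately show ?thesis by blast
qed

theorem theorem6:
  fixes a b c :: real
  assumes "a \<noteq> 0"
  shows "AE \<alpha> in lborel. \<exists>f :: nat \<Rightarrow> real. f \<longlonglongrightarrow> 0 \<and>
           (\<forall>\<^sub>F N in sequentially.
              delta_min \<alpha> (\<lambda>n. a * (real n)\<^sup>2 + b * real n + c) N < real N powr (- (2 - f N)))"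
proof -
  \<comment> \<open>Only the countably many values \<open>\<epsilon> = 1 / Suc p\<close> are taken,
    so one null set serves them all; \<open>f\<close> is then chosen for each \<alpha>.\<close>
  have "AE \<alpha> in lborel. \<forall>p. \<forall>\<^sub>F N in sequentially.
           delta_min \<alpha> (\<lambda>n. a * (real n)\<^sup>2 + b * real n + c) N \<le> 72 * real N powr (1 / Suc p - 2)"
    unfolding AE_all_countable
    by (intro allI AE_delta_min_quadratic assms) auto
  then show ?thesis
  proof eventually_elim
    case (elim \<alpha>)
    show ?case
    proof (rule exists_vanishing_exponent)
      show "\<forall>\<^sub>F N in sequentially. delta_min \<alpha> (\<lambda>n. a * (real n)\<^sup>2 + b * real n + c) N \<ge> 0"
        using eventually_ge_at_top[of 2] by eventually_elim (rule delta_min_nonneg)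
    qed (use elim in blast)
  qed
qed

end
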